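(* Let $p$ be a prime, $n\ge 1$, and let $\boldsymbol{x}\in\mathbb{Z}_p^n$ satisfy $\tau(\boldsymbol{x})=n+1$. Let $\Psi=(\psi_1,\dots,\psi_n)$ be an $n$-tuple of approximation functions such that for some $\epsilon>0$, \[ q^{-1-\frac{1}{n}+\epsilon}<\psi_i(q)<q^{-1},\qquad 1\le i\le n . \] Then there exists $N_0\in\mathbb{N}$ such that for all $N\ge N_0$, \[ \#\mathcal{Q}(\boldsymbol{x},\Psi,N)\le C_1N^{n+1}\prod_{i=1}^n\psi_i(N),\qquad C_1=\max\left\{3(6\sqrt{n})^n,\ \frac{(n+2)!\,\pi^{n/2}\sqrt{n}^{\,n+1}}{\Gamma\!\left(\frac n2+1\right)}\right\}. \]
   Context: $|\cdot|_p$ is the $p$-adic absolute value, $\mathbb{Z}_p$ the $p$-adic integers. An approximation function is a function $\psi:\mathbb{N}\to\mathbb{R}_+$ with $\psi(q)\to 0$ as $q\to\infty$. For $\boldsymbol{x}=(x_1,\dots,x_n)\in\mathbb{Z}_p^n$, the Diophantine exponent is \[ \tau(\boldsymbol{x})=\sup\Big\{\textstyle\sum_{i=1}^n\tau_i : |q_0x_i-q_i|_p<Q^{-\tau_i}\ (1\le i\le n) \text{ has an integer solution } (q_0,\dots,q_n),\ q_0\neq0,\ \max_i|q_i|\le Q, \text{ for infinitely many } Q\in\mathbb{N}\Big\}. \] For $N\in\mathbb{N}$, \[ \mathcal{Q}(\boldsymbol{x},\Psi,N)=\Big\{(q_0,\dots,q_n)\in\mathbb{Z}^{n+1}: 0<q_0\le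 N,\ \max_{1\le i\le n}|q_i|\le N,\ |q_0x_i-q_i|_p<\psi_i(N),\ 1\le i\le n\Big\}. \] *)

theory Defs
  imports "HOL-Analysis.Analysis" "HOL-Algebra.Ring" "HOL-Computational_Algebra.Primes"
    "HOL-Library.FuncSet"
begin

text \<open>
  The ring of \<open>p\<close>-adic integers as the inverse limit of the rings \<open>\<int>/p^k\<int>\<close>: an element is a
  coherent sequence of residues, the \<open>k\<close>-th one being represented in \<open>{0..<p^k}\<close>
  (so the entry with index \<open>0\<close> is always \<open>0\<close>).
\<close>

definition padic_int :: "nat \<Rightarrow> (nat \<Rightarrow> int) ring" where
  "padic_int p =
    \<lparr> carrier = {x. \<forall>k. x k \<in> {0..<int p ^ k} \<and> x (Suc k) mod int p ^ k = x k},
      monoid.mult = (\<lambda>x y k. (x k * y k) mod int p ^ k),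
      one = (\<lambda>k. 1 mod int p ^ k),
      zero = (\<lambda>k. 0),
      add = (\<lambda>x y k. (x k + y k) mod int p ^ k) \<rparr>"

definition padic_of_int :: "nat \<Rightarrow> int \<Rightarrow> nat \<Rightarrow> int" where
  "padic_of_int p a = (\<lambda>k. a mod int p ^ k)"

text \<open>
  \<open>x k = 0\<close> says that \<open>p^k\<close> divides \<open>x\<close>, so the exponent below is the \<open>p\<close>-adic valuation of \<open>x\<close>.
\<close>

definition padic_abs :: "nat \<Rightarrow> (nat \<Rightarrow> int) \<Rightarrow> real" where
  "padic_abs p x =
    (if x = \<zero>\<^bsub>padic_int p\<^esub> then 0 else 1 / real p ^ (GREATEST k. x k = 0))"

text \<open>\<open>\<bar>a x - b\<bar>\<^sub>p\<close> for integers \<open>a\<close>, \<open>b\<close> and a \<open>p\<close>-adic integer \<open>x\<close>.\<close>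

definition padic_lin_abs :: "nat \<Rightarrow> int \<Rightarrow> (nat \<Rightarrow> int) \<Rightarrow> int \<Rightarrow> real" where
  "padic_lin_abs p a x b =
    padic_abs p (padic_of_int p a \<otimes>\<^bsub>padic_int p\<^esub> x \<ominus>\<^bsub>padic_int p\<^esub> padic_of_int p b)"

definition approximation_function :: "(nat \<Rightarrow> real) \<Rightarrow> bool" where
  "approximation_function \<psi> \<longleftrightarrow> (\<forall>q\<ge>1. 0 \<le> \<psi> q) \<and> \<psi> \<longlonglongrightarrow> 0"

text \<open>
  The exponents \<open>\<tau> i\<close> range over all reals, and the supremum is taken in the extended reals,
  since it can be infinite (e.g. if some coordinate of \<open>x\<close> is rational).
\<close>

definition diophantine_exponent :: "nat \<Rightarrow> nat \<Rightarrow> (nat \<Rightarrow> nat \<Rightarrow> int) \<Rightarrow> ereal" where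
  "diophantine_exponent p n x =
    Sup {ereal (\<Sum>i=1..n. \<tau> i) | \<tau> :: nat \<Rightarrow> real.
      \<exists>\<^sub>\<infinity>Q::nat. \<exists>q :: nat \<Rightarrow> int. q 0 \<noteq> 0 \<and> (\<forall>i\<in>{0..n}. \<bar>q i\<bar> \<le> int Q) \<and>
        (\<forall>i\<in>{1..n}. padic_lin_abs p (q 0) (x i) (q i) < real Q powr (- \<tau> i))}"

text \<open>Integer vectors \<open>(q\<^sub>0, \<dots>, q\<^sub>n)\<close> are functions that are \<open>undefined\<close> outside \<open>{0..n}\<close>.\<close>

definition approx_vectors ::
    "nat \<Rightarrow> nat \<Rightarrow> (nat \<Rightarrow> nat \<Rightarrow> int) \<Rightarrow> (nat \<Rightarrow> nat \<Rightarrow> real) \<Rightarrow> nat \<Rightarrow> (nat \<Rightarrow> int) set" where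
  "approx_vectors p n x \<psi> N =
    {q \<in> {0..n} \<rightarrow>\<^sub>E (UNIV :: int set).
      0 < q 0 \<and> q 0 \<le> int N \<and> (\<forall>i\<in>{1..n}. \<bar>q i\<bar> \<le> int N) \<and>
      (\<forall>i\<in>{1..n}. padic_lin_abs p (q 0) (x i) (q i) < \<psi> i N)}"

definition C1 :: "nat \<Rightarrow> real" where
  "C1 n = max (3 * (6 * sqrt (real n)) ^ n)
    (fact (n + 2) * pi powr (real n / 2) * sqrt (real n) ^ (n + 1) / Gamma (real n / 2 + 1))"


lemma padic_int_sel [simp]:
  "monoid.mult (padic_int p) = (\<lambda>x y k. (x k * y k) mod int p ^ k)"
  "one (padic_int p) = (\<lambda>k. 1 mod int p ^ k)"
  "zero (padic_int p) = (\<lambda>k. 0)"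
  "add (padic_int p) = (\<lambda>x y k. (x k + y k) mod int p ^ k)"
  by (simp_all add: padic_int_def)

lemma padic_int_carrier_iff:
  "x \<in> carrier (padic_int p) \<longleftrightarrow> (\<forall>k. x k \<in> {0..<int p ^ k} \<and> x (Suc k) mod int p ^ k = x k)"
  by (simp add: padic_int_def)

lemma padic_int_reduce:
  assumes "p > 0" and "\<And>k. y (Suc k) mod int p ^ k = y k mod int p ^ k"
  shows "(\<lambda>k. y k mod int p ^ k) \<in> carrier (padic_int p)"
  using assms by (auto simp: padic_int_carrier_iff mod_mod_cancel)

lemma padic_int_mod: "x \<in> carrier (padic_int p) \<Longrightarrow> x k mod int p ^ k = x k"
  by (auto simp: padic_int_carrier_iff)

lemma padic_of_int_closed: "p > 0 \<Longrightarrow> padic_of_int p a \<in> carrier (padic_int p)"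
  unfolding padic_of_int_def by (rule padic_int_reduce) auto

lemma padic_int_neg:
  assumes "p > 0" "x \<in> carrier (padic_int p)"
  shows "(\<lambda>k. (- x k) mod int p ^ k) \<in> carrier (padic_int p)"
  using assms by (intro padic_int_reduce) (auto simp: padic_int_carrier_iff intro: mod_minus_cong)

lemma padic_int_cring:
  assumes p: "p > 0"
  shows "cring (padic_int p)"
proof (rule cringI)
  show "abelian_group (padic_int p)"
  proof (rule abelian_groupI)
    fix x y assume xy: "x \<in> carrier (padic_int p)" "y \<in> carrier (padic_int p)"
    have "(\<lambda>k. (x k + y k) mod int p ^ k) \<in> carrier (padic_int p)"
      using xy p by (intro padic_int_reduce) (auto simp: padic_int_carrier_iff intro: mod_add_cong)
    then show "x \<oplus>\<^bsub>padic_int p\<^esub> y \<in> carrier (padic_int p)" by simp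
  next
    fix x assume x: "x \<in> carrier (padic_int p)"
    show "\<exists>y\<in>carrier (padic_int p). y \<oplus>\<^bsub>padic_int p\<^esub> x = \<zero>\<^bsub>padic_int p\<^esub>"
      by (rule bexI[OF _ padic_int_neg[OF p x]]) (simp add: mod_simps fun_eq_iff)
  qed (auto simp: padic_int_mod mod_simps fun_eq_iff ac_simps p, simp add: padic_int_carrier_iff p)
next
  show "comm_monoid (padic_int p)"
  proof (rule comm_monoidI)
    fix x y assume xy: "x \<in> carrier (padic_int p)" "y \<in> carrier (padic_int p)"
    have "(\<lambda>k. (x k * y k) mod int p ^ k) \<in> carrier (padic_int p)"
      using xy p by (intro padic_int_reduce) (auto simp: padic_int_carrier_iff intro: mod_mult_cong)
    then show "x \<otimes>\<^bsub>padic_int p\<^esub> y \<in> carrier (padic_int p)" by simp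
  next
    show "\<one>\<^bsub>padic_int p\<^esub> \<in> carrier (padic_int p)"
      using padic_of_int_closed[OF p, of 1] by (simp add: padic_of_int_def)
  qed (auto simp: padic_int_mod mod_simps fun_eq_iff ac_simps)
qed (auto simp: padic_int_mod mod_simps fun_eq_iff algebra_simps)

lemma padic_of_int_hom: "padic_of_int p (a + b) = padic_of_int p a \<oplus>\<^bsub>padic_int p\<^esub> padic_of_int p b"
  "padic_of_int p (a * b) = padic_of_int p a \<otimes>\<^bsub>padic_int p\<^esub> padic_of_int p b"
  "padic_of_int p 1 = \<one>\<^bsub>padic_int p\<^esub>"
  by (auto simp: padic_of_int_def mod_simps)

lemma padic_lin_eval:
  assumes p: "p > 0" and x: "x \<in> carrier (padic_int p)"
  shows "padic_of_int p a \<otimes>\<^bsub>padic_int p\<^esub> x \<ominus>\<^bsub>padic_int p\<^esub> padic_of_int p b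
    = (\<lambda>k. (a * x k - b) mod int p ^ k)"
proof -
  interpret cring "padic_int p" by (rule padic_int_cring[OF p])
  have b: "padic_of_int p b \<in> carrier (padic_int p)" by (rule padic_of_int_closed[OF p])
  have "\<ominus>\<^bsub>padic_int p\<^esub> padic_of_int p b = (\<lambda>k. (- padic_of_int p b k) mod int p ^ k)"
    by (rule minus_equality) (use padic_int_neg[OF p b] b in \<open>auto simp: mod_simps\<close>)
  then show ?thesis
    by (simp add: a_minus_def padic_of_int_def mod_simps)
qed

lemma padic_abs_of_int:
  assumes p: "prime p" and a: "a \<noteq> 0"
  shows "padic_abs p (padic_of_int p a) = 1 / real p ^ multiplicity (int p) a"
proof -
  have nu: "\<not> is_unit (int p)" using prime_gt_1_nat[OF p] by simp
  have iff: "padic_of_int p a k = 0 \<longleftrightarrow> k \<le> multiplicity (int p) a" for k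
    using power_dvd_iff_le_multiplicity[of a "int p" k] a nu
    by (auto simp: padic_of_int_def dvd_eq_mod_eq_0)
  then have ne: "padic_of_int p a \<noteq> (\<lambda>k. 0)" by (metis Suc_n_not_le_n)
  have "(GREATEST k. padic_of_int p a k = 0) = multiplicity (int p) a"
    by (rule Greatest_equality) (auto simp: iff)
  with ne show ?thesis by (simp add: padic_abs_def)
qed

lemma finite_approx_vectors: "finite (approx_vectors p n x \<psi> N)"
proof (rule finite_subset)
  show "approx_vectors p n x \<psi> N \<subseteq> {0..n} \<rightarrow>\<^sub>E {- int N..int N}"
  proof
    fix q assume q: "q \<in> approx_vectors p n x \<psi> N"
    show "q \<in> {0..n} \<rightarrow>\<^sub>E {- int N..int N}"
    proof (rule PiE_I)
      fix i assume "i \<in> {0..n}"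
      then consider "i = 0" | "i \<in> {1..n}" by fastforce
      then show "q i \<in> {- int N..int N}"
        using q by cases (auto simp: approx_vectors_def abs_le_iff minus_le_iff)
    next
      fix i assume "i \<notin> {0..n}"
      then show "q i = undefined" using q by (auto simp: approx_vectors_def)
    qed
  qed
qed (intro finite_PiE, auto)

end

theory Submission
  imports Defs "HOL-Real_Asymp.Real_Asymp"
begin

text \<open>
  For fixed \<open>N\<close> the conditions \<open>\<bar>q\<^sub>0 x\<^sub>i - q\<^sub>i\<bar>\<^sub>p < \<psi>\<^sub>i(N)\<close> define a lattice of index \<open>M = \<Prod>p^k\<^sub>i\<close>, where
  \<open>k\<^sub>i\<close> is minimal with \<open>p^(-k\<^sub>i) < \<psi>\<^sub>i(N)\<close>; so \<open>1/M \<le> \<Prod>\<psi>\<^sub>i(N)\<close>, with equality up to the factor \<open>p^n\<close>.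
  Since the exponent of \<open>x\<close> is \<open>n + 1\<close>, the lattice has no nonzero vector much shorter than
  \<open>M^(1/(n+1))\<close>. If the lattice vectors of height at most \<open>B = N div (n+1)\<close> lay in a hyperplane, they
  would be determined up to a short vector by \<open>n\<close> of their coordinates rounded to a multiple of
  \<open>h\<close>, and the pigeonhole principle on \<open>{0..B}^(n+1)\<close> would give a contradiction as soon as
  \<open>2^n M \<le> B h^n\<close>. So they span, every residue class modulo the lattice has a representative of
  height at most \<open>N\<close>, and adding these \<open>M\<close> representatives to the counted points gives distinct
  integer points in a box of at most \<open>3 N (5 N)^n\<close> points.

  The exponent only bounds solutions for one tuple \<open>\<tau>\<close> at a time, while \<open>log \<psi>\<^sub>i(N) / log N\<close> varies
  with \<open>N\<close>; rounding it to a finite grid makes the bound uniform.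
\<close>

section \<open>Linear algebra: a spanning family or a hyperplane\<close>

text \<open>Gaussian elimination, one coordinate per induction step. The spanning family is chosen
  inside \<open>S\<close> itself, which later keeps the heights of the lattice vectors under
  control.\<close>

lemma spanning_or_annihilated:
  fixes S :: "('a \<Rightarrow> 'b::field) set"
  assumes "finite I"
  shows "(\<exists>a. (\<exists>i\<in>I. a i \<noteq> 0) \<and> (\<forall>s\<in>S. (\<Sum>i\<in>I. a i * s i) = 0)) \<or>
    (\<exists>v. v ` I \<subseteq> S \<and> (\<forall>c. \<exists>t. \<forall>i\<in>I. c i = (\<Sum>j\<in>I. t j * v j i)))"
  using assms
proof (induction I arbitrary: S rule: finite_induct)
  case empty
  then show ?case by auto
next
  case (insert k I)
  show ?case
  proof (cases "\<forall>s\<in>S. s k = 0")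
    case True
    have "(\<Sum>i\<in>insert k I. (if i = k then 1 else 0) * s i) = 0" if "s \<in> S" for s
    proof -
      have "(\<Sum>i\<in>I. (if i = k then 1 else 0) * s i) = 0"
        using insert.hyps by (intro sum.neutral) auto
      then show ?thesis using insert.hyps that True by simp
    qed
    then show ?thesis
      by (intro disjI1 exI[of _ "\<lambda>i. if i = k then 1 else 0"]) auto
  next
    case False
    then obtain w where w: "w \<in> S" "w k \<noteq> 0" by blast
    define red where "red s i = s i - s k / w k * w i" for s :: "'a \<Rightarrow> 'b" and i
    have redk: "red s k = 0" for s using w by (simp add: red_def)
    from insert.IH[of "red ` S"] show ?thesis
    proof (elim disjE exE conjE)
      fix a assume nz: "\<exists>i\<in>I. a i \<noteq> 0" and ann: "\<forall>s\<in>red ` S. (\<Sum>i\<in>I. a i * s i) = 0"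
      \<comment> \<open>The value at \<open>k\<close> makes \<open>a'\<close> vanish on
        \<open>w\<close>. Each \<open>s\<close> is \<open>red s\<close> plus a multiple of
        \<open>w\<close>, so \<open>a'\<close> vanishes on \<open>s\<close> as well.\<close>
      define a' where "a' = a(k := - (\<Sum>i\<in>I. a i * w i) / w k)"
      have "(\<Sum>i\<in>insert k I. a' i * s i) = 0" if "s \<in> S" for s
      proof -
        have "(\<Sum>i\<in>I. a' i * s i) = (\<Sum>i\<in>I. a i * s i)"
          using insert.hyps by (intro sum.cong) (auto simp: a'_def)
        then have "(\<Sum>i\<in>insert k I. a' i * s i)
            = (\<Sum>i\<in>I. a i * s i) - s k / w k * (\<Sum>i\<in>I. a i * w i)"
          using insert.hyps by (simp add: a'_def)
        also have "\<dots> = (\<Sum>i\<in>I. a i * red s i)"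
          by (simp add: red_def sum_subtractf sum_distrib_left algebra_simps)
        finally show ?thesis using ann that by simp
      qed
      moreover have "\<exists>i\<in>insert k I. a' i \<noteq> 0"
        using nz insert.hyps by (auto simp: a'_def)
      ultimately show ?thesis by blast
    next
      fix v assume v: "v ` I \<subseteq> red ` S"
        and sp: "\<forall>c. \<exists>t. \<forall>i\<in>I. c i = (\<Sum>j\<in>I. t j * v j i)"
      from v have "\<forall>j\<in>I. \<exists>u\<in>S. v j = red u" by blast
      then obtain u where u: "\<And>j. j \<in> I \<Longrightarrow> u j \<in> S" "\<And>j. j \<in> I \<Longrightarrow> v j = red (u j)"
        by metis
      define u' where "u' = u(k := w)"
      have "\<exists>t. \<forall>i\<in>insert k I. c i = (\<Sum>j\<in>insert k I. t j * u' j i)" for c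
      proof -
        from sp obtain t where t: "\<And>i. i \<in> I \<Longrightarrow> red c i = (\<Sum>j\<in>I. t j * v j i)"
          by blast
        \<comment> \<open>Lifting \<open>red (u j)\<close> back to \<open>u j\<close> adds
          \<open>u j k / w k\<close> times \<open>w\<close>; the coefficient of \<open>w\<close>
          compensates for this.\<close>
        define t' where "t' = t(k := c k / w k - (\<Sum>j\<in>I. t j * (u j k / w k)))"
        have "c i = (\<Sum>j\<in>insert k I. t' j * u' j i)" if i: "i \<in> insert k I" for i
        proof -
          have "red c i = (\<Sum>j\<in>I. t j * red (u j) i)"
            using i t u(2) by (cases "i = k") (auto simp: redk intro!: sum.cong)
          then have "c i = c k / w k * w i + (\<Sum>j\<in>I. t j * red (u j) i)"
            by (simp add: red_def algebra_simps)
          also have "(\<Sum>j\<in>I. t j * red (u j) i)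
              = (\<Sum>j\<in>I. t j * u j i) - (\<Sum>j\<in>I. t j * (u j k / w k)) * w i"
            unfolding sum_distrib_right sum_subtractf[symmetric]
            by (intro sum.cong) (simp_all add: red_def algebra_simps)
          also have "(\<Sum>j\<in>I. t j * u j i) = (\<Sum>j\<in>I. t' j * u' j i)"
            using insert.hyps by (intro sum.cong) (auto simp: t'_def u'_def)
          finally show ?thesis
            using insert.hyps by (simp add: t'_def u'_def algebra_simps)
        qed
        then show ?thesis by blast
      qed
      moreover have "u' ` insert k I \<subseteq> S"
        using u w by (auto simp: u'_def)
      ultimately show ?thesis by blast
    qed
  qed
qed

section \<open>Lattices given by congruences\<close>

text \<open>On \<open>{0..n}\<close> this is the kernel of the map from \<open>q\<close> to the
  residues of \<open>q 0 * X i - q i\<close> modulo \<open>m i\<close>. The map is onto already on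
  vectors with \<open>q 0 = 0\<close>, so for positive \<open>m i\<close> the index is their
  product. Values outside \<open>{0..n}\<close> are free.\<close>

definition cong_lattice :: "nat \<Rightarrow> (nat \<Rightarrow> int) \<Rightarrow> (nat \<Rightarrow> int) \<Rightarrow> (nat \<Rightarrow> int) set" where
  "cong_lattice n m X = {q. \<forall>i\<in>{1..n}. m i dvd q 0 * X i - q i}"

lemma cong_lattice_diff:
  assumes "\<And>i. i \<in> {1..n} \<Longrightarrow> (q 0 * X i - q i) mod m i = (r 0 * X i - r i) mod m i"
  shows "(\<lambda>i. q i - r i) \<in> cong_lattice n m X"
  unfolding cong_lattice_def
proof (intro CollectI ballI)
  fix i assume "i \<in> {1..n}"
  then have "m i dvd (q 0 * X i - q i) - (r 0 * X i - r i)"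
    using assms mod_eq_dvd_iff by blast
  then show "m i dvd (q 0 - r 0) * X i - (q i - r i)" by (simp add: algebra_simps)
qed

lemma cong_lattice_sum:
  assumes "finite A" "\<And>j. j \<in> A \<Longrightarrow> v j \<in> cong_lattice n m X"
  shows "(\<lambda>i. \<Sum>j\<in>A. c j * v j i) \<in> cong_lattice n m X"
  unfolding cong_lattice_def
proof (intro CollectI ballI)
  fix i assume i: "i \<in> {1..n}"
  have "(\<Sum>j\<in>A. c j * v j 0) * X i - (\<Sum>j\<in>A. c j * v j i)
      = (\<Sum>j\<in>A. c j * (v j 0 * X i - v j i))"
    by (simp add: sum_distrib_left sum_distrib_right sum_subtractf algebra_simps)
  moreover have "m i dvd \<dots>"
    using assms i by (intro dvd_sum dvd_mult) (auto simp: cong_lattice_def)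
  ultimately show "m i dvd (\<Sum>j\<in>A. c j * v j 0) * X i - (\<Sum>j\<in>A. c j * v j i)" by simp
qed

text \<open>Let \<open>j\<close> carry the largest coefficient of a relation \<open>a\<close>. Two
  box points with the same residues and the same rounded coordinates off \<open>j\<close> differ by
  a lattice vector with entries at most \<open>h\<close> off \<open>j\<close>; the relation bounds
  its entry at \<open>j\<close> by \<open>n * h\<close>, so \<open>short\<close> makes it zero. The
  resulting count contradicts \<open>large\<close>, because \<open>(B div h + 1) * h\<close> is at
  most \<open>2 * B\<close>.\<close>

lemma cong_lattice_not_annihilated:
  fixes B h :: int
  assumes m: "\<And>i. i \<in> {1..n} \<Longrightarrow> m i > 0"
    and n: "n \<ge> 1" and h: "h > 0" "h \<le> B"
    and short: "\<forall>q\<in>cong_lattice n m X. (\<forall>i\<in>{0..n}. \<bar>q i\<bar> \<le> int n * h) \<longrightarrow>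
      (\<forall>i\<in>{0..n}. q i = 0)"
    and large: "2 ^ n * (\<Prod>i=1..n. m i) \<le> B * h ^ n"
  shows "\<not> (\<exists>a :: nat \<Rightarrow> real. (\<exists>i\<in>{0..n}. a i \<noteq> 0) \<and>
      (\<forall>q\<in>cong_lattice n m X. (\<forall>i\<in>{0..n}. \<bar>q i\<bar> \<le> B) \<longrightarrow> (\<Sum>i=0..n. a i * of_int (q i)) = 0))"
proof
  assume "\<exists>a :: nat \<Rightarrow> real. (\<exists>i\<in>{0..n}. a i \<noteq> 0) \<and>
      (\<forall>q\<in>cong_lattice n m X. (\<forall>i\<in>{0..n}. \<bar>q i\<bar> \<le> B) \<longrightarrow> (\<Sum>i=0..n. a i * of_int (q i)) = 0)"
  then obtain a :: "nat \<Rightarrow> real" where nz: "\<exists>i\<in>{0..n}. a i \<noteq> 0"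
    and ann: "\<And>q. q \<in> cong_lattice n m X \<Longrightarrow> (\<And>i. i \<in> {0..n} \<Longrightarrow> \<bar>q i\<bar> \<le> B)
      \<Longrightarrow> (\<Sum>i=0..n. a i * of_int (q i)) = 0" by blast
  have "\<exists>j\<in>{0..n}. \<forall>i\<in>{0..n}. \<bar>a i\<bar> \<le> \<bar>a j\<bar>"
  proof -
    have "Max ((\<lambda>i. \<bar>a i\<bar>) ` {0..n}) \<in> (\<lambda>i. \<bar>a i\<bar>) ` {0..n}" by (rule Max_in) auto
    then obtain j where "j \<in> {0..n}" "Max ((\<lambda>i. \<bar>a i\<bar>) ` {0..n}) = \<bar>a j\<bar>" by blast
    then show ?thesis by (metis Max_ge finite_atLeastAtMost finite_imageI image_eqI)
  qed
  then obtain j where j: "j \<in> {0..n}" and jmax: "\<And>i. i \<in> {0..n} \<Longrightarrow> \<bar>a i\<bar> \<le> \<bar>a j\<bar>" by blast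
  have aj: "\<bar>a j\<bar> > 0" using nz jmax by fastforce
  define J where "J = {0..n} - {j}"
  have J: "finite J" "card J = n" "j \<notin> J" "{0..n} = insert j J"
    using j by (auto simp: J_def)
  define D where "D = ({0..n} \<rightarrow>\<^sub>E {0..B})"
  define E where "E = (\<Pi>\<^sub>E i\<in>{1..n}. {0..<m i}) \<times> (J \<rightarrow>\<^sub>E {0..B div h})"
  \<comment> \<open>The coordinate \<open>j\<close> with the largest coefficient is controlled by the others via \<open>a\<close>.\<close>
  define f where "f q = (\<lambda>i\<in>{1..n}. (q 0 * X i - q i) mod m i, \<lambda>i\<in>J. q i div h)"
    for q :: "nat \<Rightarrow> int"
  have inj: "inj_on f D"
  proof (rule inj_onI)
    fix q r assume q: "q \<in> D" and r: "r \<in> D" and eq: "f q = f r"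
    have e1: "(q 0 * X i - q i) mod m i = (r 0 * X i - r i) mod m i" if "i \<in> {1..n}" for i
    proof -
      have "fst (f q) i = fst (f r) i" by (simp add: eq)
      with that show ?thesis by (simp add: f_def)
    qed
    have e2: "q i div h = r i div h" if "i \<in> J" for i
    proof -
      have "snd (f q) i = snd (f r) i" by (simp add: eq)
      with that show ?thesis by (simp add: f_def)
    qed
    define v where "v i = q i - r i" for i
    have vL: "v \<in> cong_lattice n m X"
      using cong_lattice_diff[of n q X m r] e1 by (simp add: v_def[abs_def])
    have vB: "\<bar>v i\<bar> \<le> B" if "i \<in> {0..n}" for i
    proof -
      have "q i \<in> {0..B}" "r i \<in> {0..B}" using q r that unfolding D_def by (auto dest: PiE_mem)
      then show ?thesis by (auto simp: v_def)
    qed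
    have vJ: "\<bar>v i\<bar> \<le> h" if "i \<in> J" for i
    proof -
      have "v i = q i mod h - r i mod h"
        using e2[OF that] by (simp add: v_def minus_div_mult_eq_mod [symmetric])
      moreover have "0 \<le> q i mod h" "q i mod h < h" "0 \<le> r i mod h" "r i mod h < h"
        using h by auto
      ultimately show ?thesis by linarith
    qed
    have "(\<Sum>i=0..n. a i * of_int (v i)) = 0" using ann[OF vL] vB by blast
    then have "a j * of_int (v j) = - (\<Sum>i\<in>J. a i * of_int (v i))"
      using J by simp
    then have "\<bar>a j\<bar> * \<bar>of_int (v j)\<bar> = \<bar>\<Sum>i\<in>J. a i * of_int (v i)\<bar>"
      by (metis abs_minus_cancel abs_mult)
    also have "\<dots> \<le> (\<Sum>i\<in>J. \<bar>a i * of_int (v i)\<bar>)" by (rule sum_abs)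
    also have "\<dots> \<le> (\<Sum>i\<in>J. \<bar>a j\<bar> * of_int h)"
    proof (rule sum_mono)
      fix i assume i: "i \<in> J"
      have "\<bar>real_of_int (v i)\<bar> \<le> of_int h"
        using vJ[OF i] by linarith
      then show "\<bar>a i * of_int (v i)\<bar> \<le> \<bar>a j\<bar> * of_int h"
        unfolding abs_mult using jmax[of i] i J by (intro mult_mono) auto
    qed
    also have "\<dots> = \<bar>a j\<bar> * of_int (int n * h)" using J by simp
    finally have "\<bar>real_of_int (v j)\<bar> \<le> of_int (int n * h)" using aj by simp
    then have vj: "\<bar>v j\<bar> \<le> int n * h" by linarith
    have "h \<le> int n * h" using n h by simp
    then have "\<bar>v i\<bar> \<le> int n * h" if "i \<in> {0..n}" for i
      using that vj vJ J(4) by fastforce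
    then have "v i = 0" if "i \<in> {0..n}" for i using short vL that by blast
    then show "q = r"
      using q r unfolding D_def v_def by (intro PiE_ext) auto
  qed
  have fD: "f ` D \<subseteq> E"
  proof
    fix y assume "y \<in> f ` D"
    then obtain q where q: "q \<in> D" "y = f q" by blast
    have "q i div h \<in> {0..B div h}" if "i \<in> J" for i
    proof -
      have "q i \<in> {0..B}" using q that J unfolding D_def by (auto dest: PiE_mem)
      then show ?thesis using h by (auto simp: pos_imp_zdiv_nonneg_iff zdiv_mono1)
    qed
    then show "y \<in> E" using m unfolding q E_def f_def by auto
  qed
  have finE: "finite E" unfolding E_def using J by (intro finite_cartesian_product finite_PiE) auto
  have "card D \<le> card E" using card_inj_on_le[OF inj fD finE] .
  moreover have "int (card D) = (B + 1) ^ (n + 1)"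
    using h by (simp add: D_def card_PiE)
  moreover have "int (card E) = (\<Prod>i=1..n. m i) * (B div h + 1) ^ n"
  proof -
    have "B div h \<ge> 0" using h by (simp add: pos_imp_zdiv_nonneg_iff)
    moreover have "(\<Prod>i=1..n. int (nat (m i))) = (\<Prod>i=1..n. m i)"
      using m by (intro prod.cong) (auto simp: less_imp_le)
    ultimately show ?thesis
      using J by (simp add: E_def card_PiE card_cartesian_product prod_constant)
  qed
  ultimately have le: "(B + 1) ^ (n + 1) \<le> (\<Prod>i=1..n. m i) * (B div h + 1) ^ n"
    by (metis of_nat_le_iff)
  have M: "(\<Prod>i=1..n. m i) \<ge> 0" using m by (intro prod_nonneg) (auto simp: less_imp_le)
  have "(B div h + 1) * h \<le> 2 * B"
  proof -
    have "B div h * h \<le> B" using div_mult_mod_eq[of B h] pos_mod_sign[of h B] h by linarith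
    then show ?thesis using h by (simp add: distrib_right)
  qed
  moreover have "0 \<le> (B div h + 1) * h" using h by (simp add: pos_imp_zdiv_nonneg_iff)
  ultimately have step: "((B div h + 1) * h) ^ n \<le> (2 * B) ^ n" by (rule power_mono)
  have "(B + 1) ^ (n + 1) * h ^ n \<le> (\<Prod>i=1..n. m i) * (B div h + 1) ^ n * h ^ n"
    using le h by (intro mult_right_mono) auto
  also have "\<dots> = (\<Prod>i=1..n. m i) * ((B div h + 1) * h) ^ n"
    by (simp add: power_mult_distrib)
  also have "\<dots> \<le> (\<Prod>i=1..n. m i) * (2 * B) ^ n"
    using step M by (intro mult_left_mono)
  also have "\<dots> = (2 ^ n * (\<Prod>i=1..n. m i)) * B ^ n" by (simp add: power_mult_distrib)
  also have "\<dots> \<le> (B * h ^ n) * B ^ n" using large h by (intro mult_right_mono) auto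
  also have "\<dots> = B ^ (n + 1) * h ^ n" by simp
  \<comment> \<open>The interval \<open>{0..B}\<close> has \<open>B + 1\<close> elements; this
    surplus of one makes the inequality strict.\<close>
  also have "\<dots> < (B + 1) ^ (n + 1) * h ^ n"
    using h by (intro mult_strict_right_mono power_strict_mono) auto
  finally show False by simp
qed

text \<open>Expand \<open>c\<close> with real coefficients in \<open>n + 1\<close> spanning lattice
  vectors of height at most \<open>B\<close> and round the coefficients down. The integer part lies
  in the lattice; the rest has coefficients in [0,1), hence height at most
  \<open>(n + 1) * B\<close>.\<close>

lemma cong_lattice_covering:
  fixes B :: int
  assumes ann: "\<not> (\<exists>a :: nat \<Rightarrow> real. (\<exists>i\<in>{0..n}. a i \<noteq> 0) \<and>
      (\<forall>q\<in>cong_lattice n m X. (\<forall>i\<in>{0..n}. \<bar>q i\<bar> \<le> B) \<longrightarrow> (\<Sum>i=0..n. a i * of_int (q i)) = 0))"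
  shows "\<exists>r. (\<lambda>i. c i - r i) \<in> cong_lattice n m X \<and> (\<forall>i\<in>{0..n}. \<bar>r i\<bar> \<le> int (n + 1) * B)"
proof -
  define S where "S = (\<lambda>q i. real_of_int (q i)) ` {q \<in> cong_lattice n m X. \<forall>i\<in>{0..n}. \<bar>q i\<bar> \<le> B}"
  have "\<not> (\<exists>a. (\<exists>i\<in>{0..n}. a i \<noteq> 0) \<and> (\<forall>s\<in>S. (\<Sum>i\<in>{0..n}. a i * s i) = 0))"
  proof
    assume "\<exists>a. (\<exists>i\<in>{0..n}. a i \<noteq> 0) \<and> (\<forall>s\<in>S. (\<Sum>i\<in>{0..n}. a i * s i) = 0)"
    then obtain a where a: "\<exists>i\<in>{0..n}. a i \<noteq> 0"
      "\<And>s. s \<in> S \<Longrightarrow> (\<Sum>i\<in>{0..n}. a i * s i) = 0" by blast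
    have "(\<Sum>i=0..n. a i * of_int (q i)) = 0"
      if "q \<in> cong_lattice n m X" "\<forall>i\<in>{0..n}. \<bar>q i\<bar> \<le> B" for q
      using that by (intro a(2)) (auto simp: S_def)
    with a(1) ann show False by blast
  qed
  then obtain w where w: "w ` {0..n} \<subseteq> S"
    and sp: "\<And>c. \<exists>t. \<forall>i\<in>{0..n}. c i = (\<Sum>j\<in>{0..n}. t j * w j i)"
    using spanning_or_annihilated[of "{0..n}" S] by auto
  from w have "\<forall>j\<in>{0..n}. \<exists>v. v \<in> cong_lattice n m X \<and> (\<forall>i\<in>{0..n}. \<bar>v i\<bar> \<le> B)
      \<and> w j = (\<lambda>i. of_int (v i))"
    unfolding S_def by blast
  then obtain v where v: "\<And>j. j \<in> {0..n} \<Longrightarrow> v j \<in> cong_lattice n m X"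
    "\<And>i j. j \<in> {0..n} \<Longrightarrow> i \<in> {0..n} \<Longrightarrow> \<bar>v j i\<bar> \<le> B"
    "\<And>j. j \<in> {0..n} \<Longrightarrow> w j = (\<lambda>i. of_int (v j i))" by metis
  obtain t where t: "\<And>i. i \<in> {0..n} \<Longrightarrow> real_of_int (c i) = (\<Sum>j\<in>{0..n}. t j * w j i)"
    using sp[of "\<lambda>i. of_int (c i)"] by blast
  define r where "r i = c i - (\<Sum>j\<in>{0..n}. \<lfloor>t j\<rfloor> * v j i)" for i
  have "\<bar>r i\<bar> \<le> int (n + 1) * B" if i: "i \<in> {0..n}" for i
  proof -
    have "real_of_int (r i) = (\<Sum>j\<in>{0..n}. t j * of_int (v j i)) - (\<Sum>j\<in>{0..n}. \<lfloor>t j\<rfloor> * v j i)"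
      using t[OF i] v(3) by (simp add: r_def)
    also have "\<dots> = (\<Sum>j\<in>{0..n}. frac (t j) * of_int (v j i))"
      by (simp add: frac_def sum_subtractf algebra_simps)
    finally have "\<bar>real_of_int (r i)\<bar> \<le> (\<Sum>j\<in>{0..n}. \<bar>frac (t j) * of_int (v j i)\<bar>)"
      by simp
    also have "\<dots> \<le> (\<Sum>j\<in>{0..n}. of_int B)"
    proof (rule sum_mono)
      fix j assume j: "j \<in> {0..n}"
      have "\<bar>real_of_int (v j i)\<bar> \<le> of_int B" using v(2)[OF j i] by linarith
      moreover have "\<bar>frac (t j)\<bar> \<le> 1"
        using frac_ge_0[of "t j"] frac_lt_1[of "t j"] by linarith
      ultimately have "\<bar>frac (t j)\<bar> * \<bar>real_of_int (v j i)\<bar> \<le> 1 * of_int B"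
        by (intro mult_mono) auto
      then show "\<bar>frac (t j) * of_int (v j i)\<bar> \<le> of_int B" by (simp add: abs_mult)
    qed
    also have "\<dots> = of_int (int (n + 1) * B)" by simp
    finally show ?thesis by linarith
  qed
  moreover have "(\<lambda>i. c i - r i) \<in> cong_lattice n m X"
    using cong_lattice_sum[of "{0..n}" v n m X "\<lambda>j. \<lfloor>t j\<rfloor>"] v(1) by (simp add: r_def)
  ultimately show ?thesis by blast
qed

text \<open>The coset of \<open>q + R s\<close> gives back \<open>s\<close>, and then subtracting
  \<open>R s\<close> gives back \<open>q\<close>. So the translates of \<open>Q\<close> by small
  representatives of all classes are disjoint, and they fit in one box.\<close>

lemma cong_lattice_count:
  fixes N :: nat
  assumes m: "\<And>i. i \<in> {1..n} \<Longrightarrow> m i > 0" and N: "N \<ge> 1"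
    and cover: "\<And>c. \<exists>r. (\<lambda>i. c i - r i) \<in> cong_lattice n m X \<and> (\<forall>i\<in>{0..n}. \<bar>r i\<bar> \<le> int N)"
    and Q: "Q \<subseteq> {q \<in> {0..n} \<rightarrow>\<^sub>E UNIV. q \<in> cong_lattice n m X \<and> 0 < q 0 \<and> q 0 \<le> int N \<and>
      (\<forall>i\<in>{1..n}. \<bar>q i\<bar> \<le> int N)}"
  shows "int (card Q) * (\<Prod>i=1..n. m i) \<le> 3 * int N * (5 * int N) ^ n"
proof -
  define P where "P = (\<Pi>\<^sub>E i\<in>{1..n}. {0..<m i})"
  \<comment> \<open>At index 0 a value in \<open>{1..N}\<close> plus one in \<open>{-N..N}\<close>
    leaves exactly \<open>3 * N\<close> possibilities; elsewhere there are \<open>4 * N + 1\<close>,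
    at most \<open>5 * N\<close>.\<close>
  define F where "F i = (if i = 0 then {1 - int N..2 * int N} else {- 2 * int N..2 * int N})"
    for i :: nat
  have "\<exists>r. (\<forall>i\<in>{1..n}. m i dvd r 0 * X i - r i + s i) \<and> (\<forall>i\<in>{0..n}. \<bar>r i\<bar> \<le> int N)" for s
  proof -
    \<comment> \<open>The vector (0, s 1, ..., s n) has residues \<open>- s i\<close>, which
      explains the sign of \<open>s i\<close> in the divisibility.\<close>
    obtain r where r: "(\<lambda>i. (if i = 0 then 0 else s i) - r i) \<in> cong_lattice n m X"
      and rN: "\<forall>i\<in>{0..n}. \<bar>r i\<bar> \<le> int N"
      using cover[of "\<lambda>i. if i = 0 then 0 else s i"] by blast
    have "m i dvd r 0 * X i - r i + s i" if i: "i \<in> {1..n}" for i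
    proof -
      have "m i dvd (0 - r 0) * X i - (s i - r i)"
        using r i by (auto simp: cong_lattice_def)
      also have "(0 - r 0) * X i - (s i - r i) = - (r 0 * X i - r i + s i)"
        by simp
      finally show ?thesis by (simp only: dvd_minus_iff)
    qed
    with rN show ?thesis by blast
  qed
  then obtain R where R: "\<And>s i. i \<in> {1..n} \<Longrightarrow> m i dvd R s 0 * X i - R s i + s i"
    and RN: "\<And>s i. i \<in> {0..n} \<Longrightarrow> \<bar>R s i\<bar> \<le> int N"
    by metis
  define f where "f = (\<lambda>(q, s). \<lambda>i\<in>{0..n}. q i + R s i)"
  have inj: "inj_on f (Q \<times> P)"
  proof (rule inj_onI, clarify)
    fix q s q' s' assume q: "q \<in> Q" "q' \<in> Q" and s: "s \<in> P" "s' \<in> P"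
      and eq: "f (q, s) = f (q', s')"
    have e: "q i + R s i = q' i + R s' i" if "i \<in> {0..n}" for i
      using fun_cong[OF eq, of i] that by (simp add: f_def)
    have "s i = s' i" if i: "i \<in> {1..n}" for i
    proof -
      have d: "m i dvd q 0 * X i - q i" "m i dvd q' 0 * X i - q' i"
        using q Q i by (auto simp: cong_lattice_def)
      have "m i dvd (R s 0 * X i - R s i + s i) + (q 0 * X i - q i)
          - ((R s' 0 * X i - R s' i + s' i) + (q' 0 * X i - q' i))"
        by (rule dvd_diff[OF dvd_add[OF R[OF i] d(1)] dvd_add[OF R[OF i] d(2)]])
      also have "\<dots> = ((q 0 + R s 0) - (q' 0 + R s' 0)) * X i
          - ((q i + R s i) - (q' i + R s' i)) + (s i - s' i)"
        by (simp add: algebra_simps)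
      also have "\<dots> = s i - s' i" using e[of 0] e[of i] i by simp
      finally have "s i mod m i = s' i mod m i" by (simp add: mod_eq_dvd_iff)
      moreover have "s i \<in> {0..<m i}" "s' i \<in> {0..<m i}"
        using s i unfolding P_def by (auto dest: PiE_mem)
      ultimately show ?thesis by simp
    qed
    then have ss: "s = s'" using s unfolding P_def by (intro PiE_ext) auto
    moreover have "q = q'"
      using q Q e ss by (intro PiE_ext[of q "{0..n}" "\<lambda>_. UNIV" q']) auto
    ultimately show "q = q' \<and> s = s'" by simp
  qed
  have im: "f ` (Q \<times> P) \<subseteq> PiE {0..n} F"
  proof (clarify)
    fix q s assume q: "q \<in> Q"
    have "q i + R s i \<in> F i" if i: "i \<in> {0..n}" for i
    proof (cases "i = 0")
      case True
      then show ?thesis using q Q RN[of 0 s] by (auto simp: F_def)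
    next
      case False
      then have "\<bar>q i\<bar> \<le> int N" using q Q i by auto
      then show ?thesis using False RN[OF i, of s] by (auto simp: F_def)
    qed
    then show "f (q, s) \<in> PiE {0..n} F" by (auto simp: f_def)
  qed
  have "finite (PiE {0..n} F)" by (intro finite_PiE) (auto simp: F_def)
  from card_inj_on_le[OF inj im this]
  have "card Q * card P \<le> (\<Prod>i=0..n. card (F i))"
    by (simp add: card_cartesian_product card_PiE)
  also have "\<dots> = card (F 0) * (\<Prod>i=1..n. card (F i))"
    by (simp add: prod.atLeast_Suc_atMost)
  also have "\<dots> \<le> (3 * N) * (5 * N) ^ n"
  proof (rule mult_mono)
    have "(\<Prod>i=1..n. card (F i)) \<le> (\<Prod>i=1..n. 5 * N)"
      using N by (intro prod_mono) (auto simp: F_def)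
    then show "(\<Prod>i=1..n. card (F i)) \<le> (5 * N) ^ n" by simp
  qed (use N in \<open>auto simp: F_def\<close>)
  finally have "int (card Q * card P) \<le> int (3 * N * (5 * N) ^ n)" by linarith
  moreover have "int (card P) = (\<Prod>i=1..n. m i)"
    using m by (auto simp: P_def card_PiE less_imp_le intro!: prod.cong)
  ultimately show ?thesis by simp
qed

section \<open>p-adic inequalities as congruences modulo powers of p\<close>

text \<open>A nonzero value is \<open>1 / p ^ g\<close>, where \<open>g\<close> is the last index
  with vanishing residue. The hypotheses make \<open>k\<close> the least exponent with
  \<open>1 / p ^ k < c\<close>, so the value is below \<open>c\<close> exactly when
  \<open>k \<le> g\<close>. For \<open>k = 0\<close> both sides are true, as then
  \<open>c > 1\<close>.\<close>

lemma padic_lin_abs_less_iff: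
  assumes p: "prime p" and x: "x \<in> carrier (padic_int p)"
    and k: "1 / real p ^ k < c" "k > 0 \<Longrightarrow> c \<le> 1 / real p ^ (k - 1)"
  shows "padic_lin_abs p a x b < c \<longleftrightarrow> int p ^ k dvd a * x k - b"
proof -
  define y where "y = (\<lambda>j. (a * x j - b) mod int p ^ j)"
  have p1: "p > 1" using p prime_gt_1_nat by blast
  have c: "c > 0" using k(1) by (smt (verit) divide_nonneg_nonneg of_nat_0_le_iff zero_le_power)
  have abs: "padic_lin_abs p a x b = padic_abs p y"
    unfolding padic_lin_abs_def y_def using padic_lin_eval[OF _ x] p1 by simp
  have coh: "x (i + d) mod int p ^ i = x i" for i d
  proof (induction d)
    case 0
    then show ?case using padic_int_mod[OF x] by simp
  next
    case (Suc d)
    have "x (i + Suc d) mod int p ^ i = x (Suc (i + d)) mod int p ^ (i + d) mod int p ^ i"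
      by (simp add: mod_mod_cancel le_imp_power_dvd)
    also have "x (Suc (i + d)) mod int p ^ (i + d) = x (i + d)"
      using x by (auto simp: padic_int_carrier_iff)
    finally show ?case using Suc by simp
  qed
  \<comment> \<open>By coherence the vanishing entries of \<open>y\<close> form an initial segment,
    so vanishing at \<open>k\<close> amounts to comparing \<open>k\<close> with its last
    index.\<close>
  have down: "y i = 0" if "y j = 0" "i \<le> j" for i j
  proof -
    have "int p ^ i dvd a * x j - b"
      using that unfolding y_def
      by (meson dvd_eq_mod_eq_0 dvd_trans le_imp_power_dvd)
    moreover have "(a * x j - b) mod int p ^ i = (a * x i - b) mod int p ^ i"
      using coh[of i "j - i"] that(2)
      by (metis le_add_diff_inverse mod_diff_left_eq mod_mult_right_eq)
    ultimately show ?thesis by (simp add: y_def dvd_eq_mod_eq_0)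
  qed
  have yk: "int p ^ k dvd a * x k - b \<longleftrightarrow> y k = 0" by (simp add: y_def dvd_eq_mod_eq_0)
  show ?thesis
  proof (cases "y = (\<lambda>_. 0)")
    case True
    then show ?thesis using c yk by (simp add: abs padic_abs_def)
  next
    case False
    then obtain j where j: "y j \<noteq> 0" by auto
    define g where "g = (GREATEST k. y k = 0)"
    \<comment> \<open>\<open>GREATEST\<close> needs a bounded set of zeros; any nonvanishing entry
      \<open>j\<close> supplies the bound.\<close>
    have bnd: "\<And>i. y i = 0 \<Longrightarrow> i \<le> j" using down j by (meson nat_le_linear)
    have y0: "y 0 = 0" by (simp add: y_def)
    have yg: "y g = 0" unfolding g_def by (rule GreatestI_nat[where P = "\<lambda>i. y i = 0" and b = j, OF y0]) (rule bnd)
    have gk: "y k = 0 \<longleftrightarrow> k \<le> g"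
      using down[OF yg] Greatest_le_nat[of "\<lambda>i. y i = 0" k j] bnd by (auto simp: g_def)
    have pa: "padic_lin_abs p a x b = 1 / real p ^ g"
      using False by (simp add: abs padic_abs_def g_def)
    show ?thesis
    proof (cases "k \<le> g")
      case True
      then have "1 / real p ^ g \<le> 1 / real p ^ k"
        using p1 by (intro divide_left_mono power_increasing) auto
      then show ?thesis using True gk yk pa k(1) by simp
    next
      case False
      then have "1 / real p ^ (k - 1) \<le> 1 / real p ^ g"
        using p1 by (intro divide_left_mono power_increasing) auto
      then show ?thesis using False gk yk pa k(2) by simp
    qed
  qed
qed

lemma ex_padic_level:
  assumes p: "prime p" and c: "0 < c" "c < 1"
  obtains k where "1 / real p ^ k < c" "k > 0" "c \<le> 1 / real p ^ (k - 1)"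
proof -
  have "real p > 1" using p prime_gt_1_nat by simp
  then obtain j where "1 / c < real p ^ j" using real_arch_pow by blast
  then have "1 / real p ^ j < c" using c \<open>real p > 1\<close> by (simp add: field_simps)
  then have 1: "1 / real p ^ (LEAST j. 1 / real p ^ j < c) < c" by (rule LeastI)
  \<comment> \<open>\<open>c < 1\<close> excludes exponent 0, so subtracting 1 gives a true
    predecessor, to which minimality applies.\<close>
  have 2: "(LEAST j. 1 / real p ^ j < c) > 0"
    using 1 c by (intro gr0I) auto
  then have "\<not> 1 / real p ^ ((LEAST j. 1 / real p ^ j < c) - 1) < c"
    using not_less_Least by (metis (no_types, lifting) diff_less zero_less_one)
  with 1 2 show thesis by (intro that) auto
qed

section \<open>The exponent as an eventual obstruction to solutions\<close>

text \<open>Solutions for infinitely many \<open>Q\<close> would put the sum of the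
  \<open>\<tau> i\<close> into the set whose supremum is the exponent.\<close>

lemma diophantine_exponent_less:
  assumes "diophantine_exponent p n x < ereal (\<Sum>i=1..n. \<tau> i)"
  shows "\<forall>\<^sub>F Q in sequentially. \<forall>q :: nat \<Rightarrow> int. q 0 \<noteq> 0 \<longrightarrow> (\<forall>i\<in>{0..n}. \<bar>q i\<bar> \<le> int Q) \<longrightarrow>
    \<not> (\<forall>i\<in>{1..n}. padic_lin_abs p (q 0) (x i) (q i) < real Q powr (- \<tau> i))"
proof (rule ccontr)
  assume "\<not> ?thesis"
  then have "\<exists>\<^sub>\<infinity>Q::nat. \<exists>q :: nat \<Rightarrow> int. q 0 \<noteq> 0 \<and> (\<forall>i\<in>{0..n}. \<bar>q i\<bar> \<le> int Q) \<and>
        (\<forall>i\<in>{1..n}. padic_lin_abs p (q 0) (x i) (q i) < real Q powr (- \<tau> i))"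
    unfolding not_eventually INFM_nat frequently_sequentially by (metis less_imp_le_nat lessI order_less_le_trans)
  then have "ereal (\<Sum>i=1..n. \<tau> i) \<le> diophantine_exponent p n x"
    unfolding diophantine_exponent_def by (intro Sup_upper) blast
  with assms show False by simp
qed

section \<open>The counting bound for a fixed N\<close>

text \<open>The index \<open>M\<close> is bounded on both sides: the upper bound by the product of
  the \<open>p / \<psi> i N\<close> feeds the pigeonhole condition \<open>large\<close>, the lower
  bound trades the factor \<open>M\<close> on the count for the product of the
  \<open>\<psi> i N\<close>. Like the exponent, \<open>short\<close> speaks only of
  \<open>q 0 \<noteq> 0\<close>; the remaining lattice vectors are handled by
  \<open>\<psi> i N < 1 / N\<close>.\<close>

lemma approx_vectors_card_le:
  fixes h :: nat
  assumes p: "prime p" and n: "n \<ge> 1" and N: "N \<ge> 1"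
    and x: "\<And>i. i \<in> {1..n} \<Longrightarrow> x i \<in> carrier (padic_int p)"
    and psi: "\<And>i. i \<in> {1..n} \<Longrightarrow> 0 < \<psi> i N \<and> \<psi> i N < 1 / real N"
    and h: "h > 0" "h \<le> N div (n + 1)"
    and short: "\<And>q. q 0 \<noteq> 0 \<Longrightarrow> (\<And>i. i \<in> {0..n} \<Longrightarrow> \<bar>q i\<bar> \<le> int (n * h)) \<Longrightarrow>
      \<not> (\<forall>i\<in>{1..n}. padic_lin_abs p (q 0) (x i) (q i) < \<psi> i N)"
    and large: "2 ^ n * (\<Prod>i=1..n. real p / \<psi> i N) \<le> real (N div (n + 1)) * real h ^ n"
  shows "real (card (approx_vectors p n x \<psi> N)) \<le> 3 * real N * (5 * real N) ^ n * (\<Prod>i=1..n. \<psi> i N)"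
proof -
  have p1: "p > 1" using p prime_gt_1_nat by blast
  have psi1: "\<psi> i N < 1" if "i \<in> {1..n}" for i
  proof -
    have "\<psi> i N < 1 / real N" using psi that by blast
    also have "\<dots> \<le> 1" using N by simp
    finally show ?thesis .
  qed
  have "\<exists>k. 1 / real p ^ k < \<psi> i N \<and> k > 0 \<and> \<psi> i N \<le> 1 / real p ^ (k - 1)"
    if "i \<in> {1..n}" for i
    using ex_padic_level[OF p, of "\<psi> i N"] psi psi1 that by metis
  then obtain k where k: "\<And>i. i \<in> {1..n} \<Longrightarrow> 1 / real p ^ k i < \<psi> i N"
    "\<And>i. i \<in> {1..n} \<Longrightarrow> k i > 0" "\<And>i. i \<in> {1..n} \<Longrightarrow> \<psi> i N \<le> 1 / real p ^ (k i - 1)"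
    by metis
  define m where "m i = int p ^ k i" for i
  define X where "X i = x i (k i)" for i
  define M where "M = (\<Prod>i=1..n. m i)"
  have mpos: "m i > 0" for i using p1 by (simp add: m_def)
  have L: "q \<in> cong_lattice n m X \<longleftrightarrow> (\<forall>i\<in>{1..n}. padic_lin_abs p (q 0) (x i) (q i) < \<psi> i N)" for q
    using padic_lin_abs_less_iff[OF p x k(1) k(3)] by (simp add: cong_lattice_def m_def X_def)
  have nh: "n * h \<le> N"
  proof -
    have "n * h \<le> (n + 1) * (N div (n + 1))" using h by (intro mult_mono) auto
    also have "\<dots> \<le> N" by (rule times_div_less_eq_dividend)
    finally show ?thesis .
  qed
  have short0: "q i = 0" if q: "q \<in> cong_lattice n m X"
    and qb: "\<forall>i\<in>{0..n}. \<bar>q i\<bar> \<le> int n * int h" and i: "i \<in> {0..n}" for q i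
  proof -
    \<comment> \<open>If \<open>q 0 = 0\<close>, then \<open>m i\<close>, which exceeds \<open>1 / \<psi> i N > N\<close>, divides \<open>q i\<close>.\<close>
    have q0: "q 0 = 0" using short[of q] q qb L by auto
    show ?thesis
    proof (cases "i = 0")
      case False
      then have i1: "i \<in> {1..n}" using i by auto
      have "real N * \<psi> i N < 1" using psi[OF i1] N by (simp add: field_simps)
      moreover have "1 < \<psi> i N * real p ^ k i" using k(1)[OF i1] p1 by (simp add: field_simps)
      ultimately have "real N * \<psi> i N < real p ^ k i * \<psi> i N" by (simp add: mult.commute)
      then have "real N < real p ^ k i" using psi[OF i1] by (simp add: mult_less_cancel_right)
      then have "real_of_int (int N) < real_of_int (m i)" by (simp add: m_def)
      then have "int N < m i" by (simp only: of_int_less_iff)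
      moreover have "int (n * h) \<le> int N" using nh by (simp only: of_nat_le_iff)
      then have "\<bar>q i\<bar> \<le> int N" using qb i by fastforce
      moreover have "m i dvd q i" using q i1 q0 by (auto simp: cong_lattice_def)
      ultimately show ?thesis
        using dvd_imp_le_int[of "q i" "m i"] mpos[of i] by (cases "q i = 0") auto
    qed (simp add: q0)
  qed
  \<comment> \<open>Minimality of \<open>k i\<close> bounds \<open>p ^ (k i - 1)\<close> by
    \<open>1 / \<psi> i N\<close>; one more factor \<open>p\<close> gives
    \<open>m i\<close>.\<close>
  have Mle: "real_of_int M \<le> (\<Prod>i=1..n. real p / \<psi> i N)"
    unfolding M_def of_int_prod
  proof (intro prod_mono conjI)
    fix i assume i: "i \<in> {1..n}"
    have "real p ^ k i = real p * real p ^ (k i - 1)"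
      using k(2)[OF i] power_Suc[of "real p" "k i - 1"] by simp
    moreover have "\<psi> i N * real p ^ (k i - 1) \<le> 1"
      using k(3)[OF i] p1 by (simp add: field_simps)
    ultimately have "\<psi> i N * real p ^ k i \<le> real p"
      using mult_left_mono[of "\<psi> i N * real p ^ (k i - 1)" 1 "real p"] by (simp add: ac_simps)
    then show "real_of_int (m i) \<le> real p / \<psi> i N"
      using psi[OF i] by (simp add: m_def field_simps)
    show "0 \<le> real_of_int (m i)" using mpos[of i] by simp
  qed
  have Mge: "1 \<le> of_int M * (\<Prod>i=1..n. \<psi> i N)"
  proof -
    have "(\<Prod>i=1..n. (1::real)) \<le> (\<Prod>i=1..n. of_int (m i) * \<psi> i N)"
      using k(1) p1 by (intro prod_mono) (auto simp: m_def field_simps less_imp_le)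
    then show ?thesis by (simp add: M_def prod.distrib)
  qed
  have "2 ^ n * real_of_int M \<le> real (N div (n + 1)) * real h ^ n"
    using order_trans[OF mult_left_mono[OF Mle] large] by simp
  then have "real_of_int (2 ^ n * M) \<le> real_of_int (int (N div (n + 1)) * int h ^ n)"
    by simp
  then have large': "2 ^ n * M \<le> int (N div (n + 1)) * int h ^ n"
    by (simp only: of_int_le_iff)
  have h': "int h > 0" "int h \<le> int (N div (n + 1))" using h by auto
  have short': "\<forall>q\<in>cong_lattice n m X. (\<forall>i\<in>{0..n}. \<bar>q i\<bar> \<le> int n * int h) \<longrightarrow>
      (\<forall>i\<in>{0..n}. q i = 0)"
    using short0 by blast
  \<comment> \<open>With \<open>B = N div (n + 1)\<close> the covering height
    \<open>(n + 1) * B\<close> is at most \<open>N\<close>, as the count requires.\<close>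
  note cov = cong_lattice_covering[OF cong_lattice_not_annihilated[of n m,
        OF mpos n h' short' large'[unfolded M_def]]]
  have R: "int (n + 1) * int (N div (n + 1)) \<le> int N"
    by (metis of_nat_le_iff of_nat_mult times_div_less_eq_dividend)
  have "int (card (approx_vectors p n x \<psi> N)) * M \<le> 3 * int N * (5 * int N) ^ n"
    unfolding M_def
  proof (rule cong_lattice_count[of n m N X, OF mpos N])
    show "\<exists>r. (\<lambda>i. c i - r i) \<in> cong_lattice n m X \<and> (\<forall>i\<in>{0..n}. \<bar>r i\<bar> \<le> int N)" for c
      using cov[of c] R by (meson order_trans)
  qed (auto simp: approx_vectors_def L)
  then have "real_of_int (int (card (approx_vectors p n x \<psi> N)) * M)
      \<le> real_of_int (3 * int N * (5 * int N) ^ n)" by (simp only: of_int_le_iff)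
  then have c: "real (card (approx_vectors p n x \<psi> N)) * of_int M \<le> 3 * real N * (5 * real N) ^ n"
    by simp
  have pr: "(\<Prod>i=1..n. \<psi> i N) \<ge> 0" using psi by (intro prod_nonneg) (auto simp: less_imp_le)
  have "real (card (approx_vectors p n x \<psi> N))
      \<le> real (card (approx_vectors p n x \<psi> N)) * (of_int M * (\<Prod>i=1..n. \<psi> i N))"
    using mult_left_mono[OF Mge, of "real (card (approx_vectors p n x \<psi> N))"] by simp
  also have "\<dots> \<le> 3 * real N * (5 * real N) ^ n * (\<Prod>i=1..n. \<psi> i N)"
    using mult_right_mono[OF c pr] by (simp add: mult.assoc)
  finally show ?thesis .
qed

section \<open>Growth in N: short solutions and the scales B and h\<close>

text \<open>Use the exponent at height \<open>Q = \<lfloor>N powr \<beta>\<rfloor>\<close> with the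
  tuple \<open>g i / \<beta>\<close>. As \<open>Q\<close> is at most \<open>N powr \<beta>\<close>
  and \<open>g i \<ge> 0\<close>, rounding down only enlarges the power with exponent
  \<open>- (g i / \<beta>)\<close>, so a solution for \<open>N\<close> is one for
  \<open>Q\<close>.\<close>

lemma eventually_no_short_solution:
  assumes "diophantine_exponent p n x < ereal ((\<Sum>i=1..n. g i) / \<beta>)" "\<beta> > 0"
    and g: "\<And>i. i \<in> {1..n} \<Longrightarrow> g i \<ge> 0"
  shows "\<forall>\<^sub>F N in sequentially. \<forall>q :: nat \<Rightarrow> int. q 0 \<noteq> 0 \<longrightarrow>
    (\<forall>i\<in>{0..n}. \<bar>q i\<bar> \<le> \<lfloor>real N powr \<beta>\<rfloor>) \<longrightarrow>
    \<not> (\<forall>i\<in>{1..n}. padic_lin_abs p (q 0) (x i) (q i) < real N powr (- g i))"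
proof -
  have lim: "filterlim (\<lambda>N. nat \<lfloor>real N powr \<beta>\<rfloor>) sequentially sequentially"
    using \<open>\<beta> > 0\<close> by real_asymp
  have "diophantine_exponent p n x < ereal (\<Sum>i=1..n. g i / \<beta>)"
    using assms(1) by (simp add: sum_divide_distrib)
  from eventually_compose_filterlim[OF diophantine_exponent_less[OF this] lim]
  have ev: "\<forall>\<^sub>F N in sequentially. \<forall>q :: nat \<Rightarrow> int. q 0 \<noteq> 0 \<longrightarrow>
    (\<forall>i\<in>{0..n}. \<bar>q i\<bar> \<le> int (nat \<lfloor>real N powr \<beta>\<rfloor>)) \<longrightarrow>
    \<not> (\<forall>i\<in>{1..n}. padic_lin_abs p (q 0) (x i) (q i)
      < real (nat \<lfloor>real N powr \<beta>\<rfloor>) powr (- (g i / \<beta>)))" .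
  show ?thesis
    using ev eventually_gt_at_top[of 0]
  proof eventually_elim
    case (elim N)
    define Q where "Q = nat \<lfloor>real N powr \<beta>\<rfloor>"
    have "real N powr \<beta> \<ge> 1" using elim(2) \<open>\<beta> > 0\<close> by (intro ge_one_powr_ge_zero) auto
    then have Q: "int Q = \<lfloor>real N powr \<beta>\<rfloor>" "Q > 0" by (auto simp: Q_def le_floor_iff)
    have "real N powr (- g i) \<le> real Q powr (- (g i / \<beta>))" if "i \<in> {1..n}" for i
    proof -
      have "real N powr (- g i) = (real N powr \<beta>) powr (- (g i / \<beta>))"
        using \<open>\<beta> > 0\<close> by (simp add: powr_powr)
      also have "\<dots> \<le> real Q powr (- (g i / \<beta>))"
      proof (rule powr_mono2')
        show "real Q \<le> real N powr \<beta>" using Q(1) by linarith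
      qed (use g[OF that] \<open>\<beta> > 0\<close> Q in auto)
      finally show ?thesis .
    qed
    then have "\<forall>i\<in>{1..n}. padic_lin_abs p (q 0) (x i) (q i) < real Q powr (- (g i / \<beta>))"
      if "\<forall>i\<in>{1..n}. padic_lin_abs p (q 0) (x i) (q i) < real N powr (- g i)" for q :: "nat \<Rightarrow> int"
      using that by (meson order_less_le_trans)
    then show ?case using elim(1) unfolding Q_def[symmetric] Q(1) by blast
  qed
qed

text \<open>Up to constants, \<open>h\<close> is \<open>N powr \<beta>\<close> and \<open>B\<close>
  is \<open>N\<close>. So \<open>B * h ^ n\<close> has order
  \<open>N powr (1 + n * \<beta>)\<close>, which beats \<open>N powr \<gamma>\<close>, and
  \<open>h \<le> B\<close> follows from \<open>\<beta> < 1\<close>.\<close>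

lemma eventually_scales:
  assumes n: "n \<ge> 1" and \<beta>: "0 < \<beta>" "\<beta> < 1" and \<gamma>: "\<gamma> < 1 + real n * \<beta>"
  shows "\<forall>\<^sub>F N in sequentially. nat \<lfloor>real N powr \<beta>\<rfloor> div n > 0 \<and>
    nat \<lfloor>real N powr \<beta>\<rfloor> div n \<le> N div (n + 1) \<and>
    K * real N powr \<gamma> \<le> real (N div (n + 1)) * real (nat \<lfloor>real N powr \<beta>\<rfloor> div n) ^ n"
proof -
  \<comment> \<open>The first threshold lets rounding cost \<open>h\<close> at most a factor 2, the
    second gives \<open>h \<le> B\<close>, and the third absorbs \<open>K\<close> and the constants
    lost in rounding.\<close>
  have a1: "\<forall>\<^sub>F N in sequentially. 4 * real n \<le> real N powr \<beta>"
    using \<beta> by real_asymp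
  have a2: "\<forall>\<^sub>F N in sequentially. real N powr \<beta> \<le> real N / (2 * (real n + 1))"
    using \<beta> by real_asymp
  have d: "1 + real n * \<beta> - \<gamma> > 0" using \<gamma> by simp
  have "filterlim (\<lambda>N. real N powr (1 + real n * \<beta> - \<gamma>)) at_top sequentially"
    using d by real_asymp
  then have a3: "\<forall>\<^sub>F N in sequentially.
      K * (2 * (real n + 1) * (2 * real n) ^ n) \<le> real N powr (1 + real n * \<beta> - \<gamma>)"
    by (simp add: filterlim_at_top)
  show ?thesis
    using a1 a2 a3 eventually_ge_at_top[of "2 * (n + 1)"]
  proof eventually_elim
    case (elim N)
    define y where "y = real N powr \<beta>"
    define h where "h = nat \<lfloor>y\<rfloor> div n"
    define B where "B = N div (n + 1)"
    have N: "real N > 0" using elim by simp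
    have y: "y \<ge> 4 * real n" "y \<le> real N / (2 * (real n + 1))"
      using elim by (auto simp: y_def)
    have y0: "y > 0" using y n by simp
    have Bge: "real N / (2 * (real n + 1)) \<le> real B"
    proof -
      \<comment> \<open>Rounding \<open>2 * t\<close> down loses less than 1, and
        \<open>t \<ge> 1\<close>, so at least \<open>t\<close> remains.\<close>
      define t where "t = real N / (2 * (real n + 1))"
      have "N < (B + 1) * (n + 1)" unfolding B_def
        by (metis Suc_eq_plus1 dividend_less_div_times mult_Suc zero_less_Suc)
      then have "real N < real ((B + 1) * (n + 1))" by (simp only: of_nat_less_iff)
      then have 1: "real N / (real n + 1) < real B + 1" by (simp add: field_simps)
      have "real (2 * (n + 1)) \<le> real N" using elim(4) by (simp only: of_nat_le_iff)
      then have "1 \<le> t" by (simp add: t_def field_simps)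
      moreover have "real N / (real n + 1) = 2 * t"
        by (simp add: t_def field_simps)
      ultimately show ?thesis using 1 unfolding t_def[symmetric] by linarith
    qed
    have hge: "y / (2 * real n) \<le> real h"
    proof -
      have "nat \<lfloor>y\<rfloor> < (h + 1) * n" unfolding h_def using n
        by (metis Suc_eq_plus1 dividend_less_div_times mult_Suc less_le_trans zero_less_one)
      then have "real (nat \<lfloor>y\<rfloor>) < real ((h + 1) * n)" by (simp only: of_nat_less_iff)
      moreover have "y < real (nat \<lfloor>y\<rfloor>) + 1" using y0 by linarith
      ultimately have "y < (real h + 1) * real n + 1" by (simp add: distrib_right)
      then have "y < real h * real n + 2 * real n" using n by (simp add: distrib_right)
      then have "y / real n < real h + 2" using n by (simp add: field_simps)
      moreover have "y / real n = 2 * (y / (2 * real n))" by (simp add: field_simps)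
      moreover have "2 \<le> y / (2 * real n)" using y(1) n by (simp add: field_simps)
      ultimately show ?thesis by linarith
    qed
    have "h > 0"
    proof -
      have "0 < y / (2 * real n)" using y0 n by simp
      with hge show ?thesis by simp
    qed
    moreover have "h \<le> B"
    proof -
      have "h \<le> nat \<lfloor>y\<rfloor>" unfolding h_def by (rule div_le_dividend)
      then have "real h \<le> y" using y0 by linarith
      also have "y \<le> real B" using y(2) Bge by linarith
      finally show ?thesis by simp
    qed
    moreover have "K * real N powr \<gamma> \<le> real B * real h ^ n"
    proof -
      have "y ^ n = real N powr (real n * \<beta>)"
        using powr_realpow[OF y0, of n] by (simp add: y_def powr_powr mult.commute)
      then have e: "real N * y ^ n = real N powr (1 + real n * \<beta> - \<gamma>) * real N powr \<gamma>"
        using N by (simp add: powr_add[symmetric] powr_mult_base)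
      have "K * real N powr \<gamma> * (2 * (real n + 1) * (2 * real n) ^ n)
          \<le> real N powr (1 + real n * \<beta> - \<gamma>) * real N powr \<gamma>"
        using mult_right_mono[OF elim(3), of "real N powr \<gamma>"] by (simp add: ac_simps)
      then have "K * real N powr \<gamma> \<le> real N * y ^ n / (2 * (real n + 1) * (2 * real n) ^ n)"
        unfolding e using n by (subst pos_le_divide_eq) auto
      also have "\<dots> = real N / (2 * (real n + 1)) * (y / (2 * real n)) ^ n"
        by (simp add: power_divide)
      also have "\<dots> \<le> real B * real h ^ n"
        using Bge hge y0 n by (intro mult_mono power_mono) auto
      finally show ?thesis .
    qed
    ultimately show ?case unfolding h_def B_def y_def by blast
  qed
qed

section \<open>Uniformity in N and the final constant\<close>

theorem theorem1p2:
  fixes p n :: nat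
    and x :: "nat \<Rightarrow> nat \<Rightarrow> int"
    and \<psi> :: "nat \<Rightarrow> nat \<Rightarrow> real"
    and \<epsilon> :: real
  assumes "prime p"
    and "n \<ge> 1"
    and "\<And>i. i \<in> {1..n} \<Longrightarrow> x i \<in> carrier (padic_int p)"
    and "diophantine_exponent p n x = ereal (real n + 1)"
    and "\<And>i. i \<in> {1..n} \<Longrightarrow> approximation_function (\<psi> i)"
    and "\<epsilon> > 0"
    and "\<And>i. i \<in> {1..n} \<Longrightarrow> \<forall>\<^sub>F q in sequentially.
           real q powr (- 1 - 1 / real n + \<epsilon>) < \<psi> i q \<and> \<psi> i q < real q powr (- 1)"
  shows "\<exists>N\<^sub>0::nat. \<forall>N\<ge>N\<^sub>0.
    real (card (approx_vectors p n x \<psi> N)) \<le> C1 n * real N ^ (n + 1) * (\<Prod>i=1..n. \<psi> i N)"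
proof -
  note p = assms(1) and n = assms(2) and eps = assms(6)
  obtain m where m: "real m > (real n + 1 + \<epsilon>) / \<epsilon>\<^sup>2" using reals_Archimedean2 by blast
  have "(real n + 1 + \<epsilon>) / \<epsilon>\<^sup>2 > 0" using eps by simp
  with m have m0: "real m > 0" by linarith
  \<comment> \<open>With \<open>\<beta> = \<sigma> / (n + 1 + \<epsilon>)\<close> the exponents \<open>G i / (m \<beta>)\<close> add up to \<open>n + 1 + \<epsilon>\<close>, and for
    \<open>\<sigma> \<le> n + 1 - n \<epsilon>\<close> the choice of \<open>m\<close> gives \<open>\<sigma> + n / m < 1 + n \<beta>\<close>.\<close>
  define grid where "grid = ({1..n} \<rightarrow>\<^sub>E {m..2 * m})"
  define \<sigma> where "\<sigma> G = (\<Sum>i=1..n. real (G i) / real m)" for G :: "nat \<Rightarrow> nat"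
  define \<beta> where "\<beta> G = \<sigma> G / (real n + 1 + \<epsilon>)" for G :: "nat \<Rightarrow> nat"
  \<comment> \<open>Division by \<open>n\<close> keeps vectors of height \<open>n * h G N\<close>
    within height \<open>N powr \<beta> G\<close>, where the exponent applies.\<close>
  define h where "h G N = nat \<lfloor>real N powr \<beta> G\<rfloor> div n" for G N
  \<comment> \<open>These are the facts about large \<open>N\<close> that the count needs for one
    grid tuple; \<open>n / m\<close> is room for rounding the true exponents down to the
    grid.\<close>
  define good where "good G N \<longleftrightarrow>
      (\<forall>q :: nat \<Rightarrow> int. q 0 \<noteq> 0 \<longrightarrow> (\<forall>i\<in>{0..n}. \<bar>q i\<bar> \<le> \<lfloor>real N powr \<beta> G\<rfloor>) \<longrightarrow>
        \<not> (\<forall>i\<in>{1..n}. padic_lin_abs p (q 0) (x i) (q i) < real N powr (- (real (G i) / real m)))) \<and>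
      h G N > 0 \<and> h G N \<le> N div (n + 1) \<and>
      (2 * real p) ^ n * real N powr (\<sigma> G + real n / real m)
        \<le> real (N div (n + 1)) * real (h G N) ^ n" for G N
  \<comment> \<open>Tuples with larger \<open>\<sigma> G\<close> are exempt: those obtained below by
    rounding satisfy the bound.\<close>
  have good: "\<forall>\<^sub>F N in sequentially. \<sigma> G \<le> real n + 1 - real n * \<epsilon> \<longrightarrow> good G N" if G: "G \<in> grid" for G
  proof (cases "\<sigma> G \<le> real n + 1 - real n * \<epsilon>")
    case True
    have "(\<Sum>i=1..n. (1::real)) \<le> \<sigma> G" unfolding \<sigma>_def
    proof (rule sum_mono)
      fix i assume "i \<in> {1..n}"
      then have "m \<le> G i" using G by (auto simp: grid_def dest: PiE_mem)
      then show "1 \<le> real (G i) / real m" using m0 by simp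
    qed
    then have sn: "\<sigma> G \<ge> real n" by simp
    have s0: "\<sigma> G > 0" using sn n by linarith
    have b0: "\<beta> G > 0" using s0 eps by (simp add: \<beta>_def add_pos_pos)
    have "\<sigma> G < real n + 1 + \<epsilon>" using True eps n by (smt (verit) mult_nonneg_nonneg of_nat_0_le_iff)
    then have b1: "\<beta> G < 1" using eps by (simp add: \<beta>_def)
    have sb: "\<sigma> G / \<beta> G = real n + 1 + \<epsilon>" using s0 eps by (simp add: \<beta>_def)
    \<comment> \<open>Multiplied by \<open>n + 1 + \<epsilon>\<close>, the claim becomes
      \<open>\<sigma> G * (1 + \<epsilon>) + n / m * (n + 1 + \<epsilon>) < n + 1 +
      \<epsilon>\<close>. The bound on \<open>\<sigma> G\<close> leaves a slack of n times the
      square of \<open>\<epsilon>\<close>, and \<open>m\<close> is large enough for the second term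
      to stay below it.\<close>
    have gam: "\<sigma> G + real n / real m < 1 + real n * \<beta> G"
    proof -
      have "(real n + 1 + \<epsilon>) < real m * \<epsilon>\<^sup>2" using m eps by (simp add: field_simps)
      then have "real n * (real n + 1 + \<epsilon>) < real n * (real m * \<epsilon>\<^sup>2)" using n by simp
      then have "real n / real m * (real n + 1 + \<epsilon>) < real n * \<epsilon>\<^sup>2"
        using m0 by (simp add: field_simps)
      moreover have "\<sigma> G * (1 + \<epsilon>) \<le> (real n + 1 - real n * \<epsilon>) * (1 + \<epsilon>)"
        using True eps by (intro mult_right_mono) auto
      ultimately have "(\<sigma> G + real n / real m) * (real n + 1 + \<epsilon>)
          < (real n + 1 + \<epsilon>) + real n * \<sigma> G"
        by (simp add: algebra_simps power2_eq_square)
      then have "\<sigma> G + real n / real m < ((real n + 1 + \<epsilon>) + real n * \<sigma> G) / (real n + 1 + \<epsilon>)"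
        using eps by (subst pos_less_divide_eq) auto
      also have "\<dots> = 1 + real n * \<beta> G" using eps by (simp add: \<beta>_def add_divide_distrib)
      finally show ?thesis .
    qed
    have "diophantine_exponent p n x < ereal ((\<Sum>i=1..n. real (G i) / real m) / \<beta> G)"
      unfolding sb[unfolded \<sigma>_def] using eps by (simp add: assms(4))
    from eventually_no_short_solution[OF this b0]
      eventually_scales[OF n b0 b1 gam, of "(2 * real p) ^ n"]
    have "\<forall>\<^sub>F N in sequentially. good G N"
      unfolding good_def h_def by (auto simp: eventually_conj_iff)
    then show ?thesis by (rule eventually_mono) blast
  qed auto
  \<comment> \<open>Finitely many tuples share one threshold, which therefore serves a tuple that
    varies with \<open>N\<close>.\<close>
  have "finite grid" unfolding grid_def by (intro finite_PiE) auto
  then have "\<forall>\<^sub>F N in sequentially. \<forall>G\<in>grid. \<sigma> G \<le> real n + 1 - real n * \<epsilon> \<longrightarrow> good G N"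
    using good by (intro eventually_ball_finite) auto
  moreover have "\<forall>\<^sub>F N in sequentially. \<forall>i\<in>{1..n}.
      real N powr (- 1 - 1 / real n + \<epsilon>) < \<psi> i N \<and> \<psi> i N < real N powr (- 1)"
    using assms(7) by (intro eventually_ball_finite) auto
  ultimately have "\<forall>\<^sub>F N in sequentially.
    real (card (approx_vectors p n x \<psi> N)) \<le> C1 n * real N ^ (n + 1) * (\<Prod>i=1..n. \<psi> i N)"
    using eventually_ge_at_top[of 2]
  proof eventually_elim
    case (elim N)
    have N: "real N > 1" using elim(3) by simp
    define s where "s i = - log (real N) (\<psi> i N)" for i
    have psi0: "\<psi> i N > 0" if "i \<in> {1..n}" for i
      using elim(2) that by (meson le_less_trans powr_ge_zero)
    have psis: "\<psi> i N = real N powr (- s i)" if "i \<in> {1..n}" for i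
      using psi0[OF that] N by (simp add: s_def)
    have s: "1 < s i" "s i < 1 + 1 / real n - \<epsilon>" if i: "i \<in> {1..n}" for i
    proof -
      have "real N powr (- 1 - 1 / real n + \<epsilon>) < real N powr (- s i)"
        "real N powr (- s i) < real N powr (- 1)"
        using elim(2) i psis by auto
      then show "1 < s i" "s i < 1 + 1 / real n - \<epsilon>"
        using N by (simp_all only: powr_less_cancel_iff)
    qed
    \<comment> \<open>Rounding down gives \<open>\<psi> i N \<le> N powr (- (G i / m))\<close>, the
      direction needed to exclude short solutions, and loses at most \<open>1 / m\<close> per
      coordinate. The entries lie in \<open>{m..2 * m}\<close> because
      \<open>1 < s i < 2\<close>.\<close>
    define G where "G = (\<lambda>i\<in>{1..n}. nat \<lfloor>real m * s i\<rfloor>)"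
    have G: "real (G i) \<le> real m * s i" "real m * s i < real (G i) + 1" "G i \<in> {m..2 * m}"
      if i: "i \<in> {1..n}" for i
    proof -
      have Gi: "G i = nat \<lfloor>real m * s i\<rfloor>" using i by (simp add: G_def)
      have "1 / real n \<le> 1" using n by simp
      then have "s i < 2" using s[OF i] eps by linarith
      then have u: "real m * s i \<le> real m * 2" using m0 by (intro mult_left_mono) auto
      have l: "real m * 1 \<le> real m * s i" using s(1)[OF i] m0 by (intro mult_left_mono) auto
      show a: "real (G i) \<le> real m * s i" using l m0 unfolding Gi by linarith
      show "real m * s i < real (G i) + 1" unfolding Gi by linarith
      have "m \<le> G i" unfolding Gi using l by (simp add: le_nat_floor)
      moreover have "real (G i) \<le> real (2 * m)" using a u by simp
      ultimately show "G i \<in> {m..2 * m}" by (simp only: of_nat_le_iff atLeastAtMost_iff)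
    qed
    have Ggrid: "G \<in> grid" unfolding grid_def
      using G(3) by (intro PiE_I) (auto simp: G_def)
    have gs: "real (G i) / real m \<le> s i" "s i \<le> real (G i) / real m + 1 / real m"
      if "i \<in> {1..n}" for i
      using G[OF that] m0 by (auto simp: field_simps)
    have "\<sigma> G \<le> (\<Sum>i=1..n. s i)" unfolding \<sigma>_def using gs by (intro sum_mono) auto
    also have "\<dots> \<le> (\<Sum>i=1..n. 1 + 1 / real n - \<epsilon>)" using s by (intro sum_mono) (auto intro: less_imp_le)
    also have "\<dots> = real n + 1 - real n * \<epsilon>" using n by (simp add: algebra_simps)
    finally have gd: "good G N" using elim(1) Ggrid by blast
    have "(\<Sum>i=1..n. s i) \<le> (\<Sum>i=1..n. real (G i) / real m + 1 / real m)"
      using gs by (intro sum_mono) auto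
    then have ssum: "(\<Sum>i=1..n. s i) \<le> \<sigma> G + real n / real m"
      by (simp add: \<sigma>_def sum.distrib)
    have "real (card (approx_vectors p n x \<psi> N))
        \<le> 3 * real N * (5 * real N) ^ n * (\<Prod>i=1..n. \<psi> i N)"
    proof (rule approx_vectors_card_le[OF p n _ assms(3)])
      show "0 < \<psi> i N \<and> \<psi> i N < 1 / real N" if "i \<in> {1..n}" for i
        using elim(2) that psi0 N by (auto simp: powr_minus_divide)
      show "h G N > 0" "h G N \<le> N div (n + 1)" using gd by (auto simp: good_def)
      show "\<not> (\<forall>i\<in>{1..n}. padic_lin_abs p (q 0) (x i) (q i) < \<psi> i N)"
        if q: "q 0 \<noteq> 0" "\<And>i. i \<in> {0..n} \<Longrightarrow> \<bar>q i\<bar> \<le> int (n * h G N)" for q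
      proof
        assume a: "\<forall>i\<in>{1..n}. padic_lin_abs p (q 0) (x i) (q i) < \<psi> i N"
        have "n * h G N \<le> nat \<lfloor>real N powr \<beta> G\<rfloor>"
          unfolding h_def by (rule times_div_less_eq_dividend)
        moreover have "\<lfloor>real N powr \<beta> G\<rfloor> \<ge> 0" by simp
        ultimately have "int (n * h G N) \<le> \<lfloor>real N powr \<beta> G\<rfloor>" by linarith
        then have "\<forall>i\<in>{0..n}. \<bar>q i\<bar> \<le> \<lfloor>real N powr \<beta> G\<rfloor>" using q(2) by fastforce
        moreover have "\<psi> i N \<le> real N powr (- (real (G i) / real m))" if "i \<in> {1..n}" for i
          unfolding psis[OF that] using gs(1)[OF that] N by (intro powr_mono) auto
        then have "\<forall>i\<in>{1..n}. padic_lin_abs p (q 0) (x i) (q i)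
            < real N powr (- (real (G i) / real m))"
          using a by (meson order_less_le_trans)
        ultimately show False using gd q(1) unfolding good_def by blast
      qed
      \<comment> \<open>The upper bound for \<open>M\<close> is \<open>p ^ n\<close> times
        \<open>N\<close> to the sum of the \<open>s i\<close>, and that sum exceeds
        \<open>\<sigma> G\<close> by at most \<open>n / m\<close>.\<close>
      have "(\<Prod>i=1..n. real p / \<psi> i N) = (\<Prod>i=1..n. real p * real N powr s i)"
        by (intro prod.cong) (auto simp: psis powr_minus divide_inverse)
      also have "\<dots> = real p ^ n * real N powr (\<Sum>i=1..n. s i)"
        using N by (simp add: prod.distrib powr_sum)
      also have "\<dots> \<le> real p ^ n * real N powr (\<sigma> G + real n / real m)"
        using ssum N by (intro mult_left_mono powr_mono) auto
      finally have "2 ^ n * (\<Prod>i=1..n. real p / \<psi> i N)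
          \<le> (2 * real p) ^ n * real N powr (\<sigma> G + real n / real m)"
        by (simp add: power_mult_distrib)
      also have "\<dots> \<le> real (N div (n + 1)) * real (h G N) ^ n"
        using gd unfolding good_def by blast
      finally show "2 ^ n * (\<Prod>i=1..n. real p / \<psi> i N)
          \<le> real (N div (n + 1)) * real (h G N) ^ n" .
    qed (use N in auto)
    also have "\<dots> = (3 * 5 ^ n) * real N ^ (n + 1) * (\<Prod>i=1..n. \<psi> i N)"
      by (simp add: power_mult_distrib)
    also have "\<dots> \<le> C1 n * real N ^ (n + 1) * (\<Prod>i=1..n. \<psi> i N)"
    proof (intro mult_right_mono)
      \<comment> \<open>The first entry of the maximum in \<open>C1\<close> dominates
        \<open>3 * 5 ^ n\<close>.\<close>
      have "sqrt (real n) \<ge> 1" using n by simp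
      then have "5 \<le> 6 * sqrt (real n)" by linarith
      then have "(5::real) ^ n \<le> (6 * sqrt (real n)) ^ n" by (rule power_mono) auto
      then show "3 * 5 ^ n \<le> C1 n" unfolding C1_def by (simp add: le_max_iff_disj)
      show "(\<Prod>i=1..n. \<psi> i N) \<ge> 0" using psi0 by (intro prod_nonneg) (auto intro: less_imp_le)
    qed auto
    finally show ?case .
  qed
  then show ?thesis by (simp add: eventually_sequentially)
qed

end
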